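(* Let $1\le p<\infty$ and let $q$ be the conjugate exponent of $p$ ($\frac1p+\frac1q=1$, $q=\infty$ if $p=1$). Let $A$ be in any of the classes $(\ell_p(\Delta^{(\tilde\alpha)}),c_0)$, $(\ell_p(\Delta^{(\tilde\alpha)}),c)$ or $(\ell_p(\Delta^{(\tilde\alpha)}),\ell_\infty)$. Then $$\|L_A\|=\|A\|_{(\ell_p(\Delta^{(\tilde\alpha)}),\ell_\infty)},\qquad\text{where}\qquad \|A\|_{(\ell_p(\Delta^{(\tilde\alpha)}),\ell_\infty)}=\sup_n\Big(\sum_{k=0}^\infty|\hat a_{nk}|^q\Big)^{1/q}<\infty,$$ the inner expression being read as $\sup_k|\hat a_{nk}|$ when $p=1$.
   Context: $\omega$ is the set of all complex sequences $x=(x_k)_{k\ge0}$; $c_0$, $c$, $\ell_\infty$ (null, convergent, bounded sequences) carry the sup norm, and $\ell_p$ its usual norm. Fix a fraction $\tilde\alpha$ (a real non-integer number). For $x\in\omega$ put $$(\Delta^{(\tilde\alpha)}x)_k=\sum_{i=0}^{k}(-1)^i\frac{\Gamma(\tilde\alpha+1)}{i!\,\Gamma(\tilde\alpha-i+1)}x_{k-i}$$ (terms with negative index are zero). Then $\ell_p(\Delta^{(\tilde\alpha)})=\{x\in\omega:\Delta^{(\tilde\alpha)}x\in\ell_p\}$, a Banach space with norm $\|x\|=\|\Delta^{(\tilde\alpha)}x\|_{\ell_p}$. For an infinite complex matrix $A=(a_{nk})_{n,k\ge0}$ and $X,Y\subset\omega$, $A\in(X,Y)$ means that for every $x\in X$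 the series $A_nx=\sum_{k=0}^\infty a_{nk}x_k$ converges for all $n$ and $Ax=(A_nx)_{n\ge0}\in Y$. $L_A:X\to Y$ denotes the (bounded) operator $L_A(x)=Ax$, and $\|L_A\|$ its operator norm. The matrix $\hat A=(\hat a_{nk})$ associated with $A$ is $$\hat a_{nk}=\sum_{j=k}^\infty(-1)^{j-k}\frac{\Gamma(-\tilde\alpha+1)}{(j-k)!\,\Gamma(-\tilde\alpha-j+k+1)}a_{nj}$$ (these series converge whenever $A$ maps $\ell_p(\Delta^{(\tilde\alpha)})$ into some subset of $\omega$). *)

theory Defs
  imports "HOL-Analysis.Analysis"
begin

text \<open>
  The norm of \<open>\<ell>\<^sub>r\<close> on all of \<open>\<omega>\<close>, for an exponent \<open>r\<close> in \<open>[1, \<infinity>]\<close>; it takes the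
  value \<open>\<infinity>\<close> exactly off \<open>\<ell>\<^sub>r\<close>.  The case distinction on summability is needed because a
  divergent real series has an unspecified \<^const>\<open>suminf\<close>.
\<close>

definition ell_norm :: "ennreal \<Rightarrow> (nat \<Rightarrow> complex) \<Rightarrow> ennreal" where
  "ell_norm r x =
     (if r = \<infinity> then (SUP k. ennreal (cmod (x k)))
      else if summable (\<lambda>k. cmod (x k) powr enn2real r)
        then ennreal ((\<Sum>k. cmod (x k) powr enn2real r) powr (1 / enn2real r))
      else \<infinity>)"

definition ell :: "ennreal \<Rightarrow> (nat \<Rightarrow> complex) set" where
  "ell r = {x. ell_norm r x < \<infinity>}"

definition null_seqs :: "(nat \<Rightarrow> complex) set" where
  "null_seqs = {x. x \<longlonglongrightarrow> 0}"

definition convergent_seqs :: "(nat \<Rightarrow> complex) set" where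
  "convergent_seqs = {x. convergent x}"

definition frac_coeff :: "real \<Rightarrow> nat \<Rightarrow> real" where
  "frac_coeff \<alpha> i = (-1) ^ i * (Gamma (\<alpha> + 1) / (fact i * Gamma (\<alpha> - real i + 1)))"

definition frac_diff :: "real \<Rightarrow> (nat \<Rightarrow> complex) \<Rightarrow> nat \<Rightarrow> complex" where
  "frac_diff \<alpha> x k = (\<Sum>i\<le>k. of_real (frac_coeff \<alpha> i) * x (k - i))"

definition ell_frac_norm :: "real \<Rightarrow> ennreal \<Rightarrow> (nat \<Rightarrow> complex) \<Rightarrow> ennreal" where
  "ell_frac_norm \<alpha> p x = ell_norm p (frac_diff \<alpha> x)"

definition ell_frac :: "real \<Rightarrow> ennreal \<Rightarrow> (nat \<Rightarrow> complex) set" where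
  "ell_frac \<alpha> p = {x. frac_diff \<alpha> x \<in> ell p}"

definition mat_apply :: "(nat \<Rightarrow> nat \<Rightarrow> complex) \<Rightarrow> (nat \<Rightarrow> complex) \<Rightarrow> nat \<Rightarrow> complex" where
  "mat_apply A x n = (\<Sum>k. A n k * x k)"

definition mat_class ::
    "(nat \<Rightarrow> complex) set \<Rightarrow> (nat \<Rightarrow> complex) set \<Rightarrow> (nat \<Rightarrow> nat \<Rightarrow> complex) set" where
  "mat_class X Y = {A. \<forall>x\<in>X. (\<forall>n. summable (\<lambda>k. A n k * x k)) \<and> mat_apply A x \<in> Y}"

text \<open>
  The operator norm of a map \<open>T\<close> from the space \<open>X\<close> with norm \<open>N\<close> to a space with norm \<open>N'\<close>;
  it is finite iff \<open>T\<close> is bounded on the unit ball.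
\<close>

definition op_norm ::
    "(nat \<Rightarrow> complex) set \<Rightarrow> ((nat \<Rightarrow> complex) \<Rightarrow> ennreal) \<Rightarrow> ((nat \<Rightarrow> complex) \<Rightarrow> ennreal) \<Rightarrow>
      ((nat \<Rightarrow> complex) \<Rightarrow> (nat \<Rightarrow> complex)) \<Rightarrow> ennreal" where
  "op_norm X N N' T = (SUP x\<in>{x \<in> X. N x \<le> 1}. N' (T x))"

text \<open>
  The index of the series over \<open>j \<ge> k\<close> is shifted to \<open>i = j - k\<close>.
\<close>

definition hat_mat :: "real \<Rightarrow> (nat \<Rightarrow> nat \<Rightarrow> complex) \<Rightarrow> nat \<Rightarrow> nat \<Rightarrow> complex" where
  "hat_mat \<alpha> A n k = (\<Sum>i. of_real (frac_coeff (- \<alpha>) i) * A n (k + i))"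

definition mat_norm :: "real \<Rightarrow> ennreal \<Rightarrow> (nat \<Rightarrow> nat \<Rightarrow> complex) \<Rightarrow> ennreal" where
  "mat_norm \<alpha> q A = (SUP n. ell_norm q (hat_mat \<alpha> A n))"

lemma frac_coeff_gbinomial:
  assumes "\<alpha> \<notin> \<int>"
  shows "frac_coeff \<alpha> i = (-1) ^ i * (\<alpha> gchoose i)"
proof -
  have "\<alpha> + 1 \<notin> \<int>\<^sub>\<le>\<^sub>0"
    using assms by (metis Ints_1 Ints_diff add_diff_cancel_right' nonpos_Ints_Int)
  then show ?thesis
    by (simp add: frac_coeff_def gbinomial_Gamma)
qed

lemma frac_coeff_convolution:
  assumes "\<alpha> \<notin> \<int>"
  shows "(\<Sum>i\<le>m. frac_coeff \<alpha> i * frac_coeff (- \<alpha>) (m - i)) = (if m = 0 then 1 else 0)"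
proof -
  have "- \<alpha> \<notin> \<int>" using assms by simp
  then have "(\<Sum>i\<le>m. frac_coeff \<alpha> i * frac_coeff (- \<alpha>) (m - i))
      = (\<Sum>i\<le>m. (-1) ^ m * ((\<alpha> gchoose i) * (- \<alpha> gchoose (m - i))))"
    by (intro sum.cong refl)
       (auto simp: frac_coeff_gbinomial assms power_add[symmetric] mult_ac)
  also have "\<dots> = (-1) ^ m * ((\<alpha> + - \<alpha>) gchoose m)"
    by (simp only: sum_distrib_left[symmetric] gbinomial_Vandermonde[symmetric] atMost_atLeast0)
  also have "\<dots> = (if m = 0 then 1 else 0)"
    by (cases m) (auto simp: gbinomial_0)
  finally show ?thesis .
qed

text \<open>The series defining \<^const>\<open>hat_mat\<close> converge for every matrix that acts on
  \<open>\<ell>\<^sub>p(\<Delta>\<^sup>\<alpha>)\<close>, so \<^const>\<open>hat_mat\<close> has its intended value there.\<close>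

lemma summable_hat_mat:
  assumes "\<alpha> \<notin> \<int>" and A: "A \<in> mat_class (ell_frac \<alpha> p) Y"
  shows "summable (\<lambda>i. of_real (frac_coeff (- \<alpha>) i) * A n (k + i))"
proof -
  define x :: "nat \<Rightarrow> complex"
    where "x j = (if j < k then 0 else of_real (frac_coeff (- \<alpha>) (j - k)))" for j
  have d: "frac_diff \<alpha> x = (\<lambda>m. if m = k then 1 else 0)"
  proof
    fix m
    show "frac_diff \<alpha> x m = (if m = k then 1 else 0)"
    proof (cases "m < k")
      case True
      then show ?thesis by (auto simp: frac_diff_def x_def intro!: sum.neutral)
    next
      case False
      have "frac_diff \<alpha> x m
          = (\<Sum>i\<le>m - k. of_real (frac_coeff \<alpha> i) * x (m - i))"
        unfolding frac_diff_def using False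
        by (intro sum.mono_neutral_right) (auto simp: x_def)
      also have "\<dots> = (\<Sum>i\<le>m - k. of_real (frac_coeff \<alpha> i * frac_coeff (- \<alpha>) ((m - k) - i)))"
        using False by (intro sum.cong refl) (auto simp: x_def add.commute)
      also have "\<dots> = of_real (if m - k = 0 then 1 else 0)"
        by (simp only: of_real_sum[symmetric] frac_coeff_convolution[OF assms(1)])
      finally show ?thesis using False by auto
    qed
  qed
  have "x \<in> ell_frac \<alpha> p"
  proof (cases "p = \<infinity>")
    case True
    have "(SUP m. ennreal (cmod (if m = k then 1 else 0))) \<le> 1"
      by (rule SUP_least) auto
    then have "(SUP m. ennreal (cmod (if m = k then 1 else 0))) < \<infinity>"
      by (rule order.strict_trans1) simp
    with True show ?thesis by (simp add: ell_frac_def ell_def ell_norm_def d)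
  next
    case False
    have "summable (\<lambda>m. cmod (if m = k then 1 else 0) powr enn2real p)"
      by (rule summable_finite[of "{k}"]) auto
    with False show ?thesis by (simp add: ell_frac_def ell_def ell_norm_def d)
  qed
  with A have "summable (\<lambda>j. A n j * x j)" by (auto simp: mat_class_def)
  then have "summable (\<lambda>i. A n (i + k) * x (i + k))"
    by (simp only: summable_iff_shift[of "\<lambda>j. A n j * x j"])
  then show ?thesis by (simp add: x_def mult.commute add.commute)
qed

end

theory Submission
  imports Defs
begin

text \<open>
  Since \<open>\<Delta>\<^sup>\<alpha>\<close> is convolution with the coefficients of \<open>(1 - z)\<^sup>\<alpha>\<close>, it is inverted by
  \<open>\<Delta>\<^bsup>-\<alpha>\<^esup>\<close>, which therefore maps \<open>\<ell>\<^sub>p\<close> isometrically onto \<open>\<ell>\<^sub>p(\<Delta>\<^sup>\<alpha>)\<close>.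
  For fixed \<open>n\<close> the functional \<open>y \<mapsto> A\<^sub>n(\<Delta>\<^bsup>-\<alpha>\<^esup>y)\<close> is a pointwise limit of bounded functionals,
  hence bounded on \<open>\<ell>\<^sub>p\<close> by uniform boundedness; as it takes the value \<open>hat_mat \<alpha> A n k\<close> at the \<open>k\<close>-th unit
  sequence, its norm is the \<open>\<ell>\<^sub>q\<close> norm of the \<open>n\<close>-th row of the associated matrix.  Uniform
  boundedness over \<open>n\<close> makes the supremum of these norms finite.
\<close>

subsection \<open>The sequence spaces \<open>\<ell>\<^sub>p\<close> and the \<open>\<sigma>\<close>-convexity of their unit balls\<close>

definition lp :: "real \<Rightarrow> (nat \<Rightarrow> complex) set" where
  "lp P = {y. summable (\<lambda>k. cmod (y k) powr P)}"

text \<open>Bounding every finite partial sum by 1 avoids both roots and summability side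
  conditions. Each of these conditions involves finitely many coordinates and so survives
  coordinatewise limits.\<close>

definition lp_ball :: "real \<Rightarrow> (nat \<Rightarrow> complex) set" where
  "lp_ball P = {y. \<forall>K. (\<Sum>k<K. cmod (y k) powr P) \<le> 1}"

text \<open>Entries of a sequence may vanish, so the endpoint 0 is included. If one argument is 0,
  the claim reduces to w powr P \<le> w for w in [0,1]; otherwise it is convexity on the open
  half-line.\<close>

lemma convex_on_powr_nonneg:
  assumes "P \<ge> 1"
  shows "convex_on {0..} (\<lambda>x::real. x powr P)"
  unfolding convex_on_def
proof (intro conjI ballI allI impI)
  fix x y u v :: real
  assume h: "x \<in> {0..}" "y \<in> {0..}" "0 \<le> u" "0 \<le> v" "u + v = 1"
  have scale: "(w * t) powr P \<le> w * t powr P" if "0 \<le> w" "w \<le> 1" "0 \<le> t" for w t :: real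
  proof -
    have "w powr P \<le> w"
      using powr_mono'[of 1 P w] assms that by auto
    then show ?thesis
      using that by (simp add: powr_mult mult_right_mono)
  qed
  show "(u *\<^sub>R x + v *\<^sub>R y) powr P \<le> u * x powr P + v * y powr P"
  proof (cases "x = 0 \<or> y = 0")
    case True
    then show ?thesis
      using scale[of u x] scale[of v y] h by auto
  next
    case False
    then show ?thesis
      using powr_convex[OF assms] h unfolding convex_on_def by auto
  qed
qed (rule convex_real_interval)

text \<open>Jensen's inequality for weights of total mass at most 1: the missing mass is put on an
  extra index N, where the value is 0.\<close>

lemma powr_sum_le_sum_powr:
  fixes w t :: "nat \<Rightarrow> real"
  assumes "P \<ge> 1" and w: "\<And>n. w n \<ge> 0" "(\<Sum>n<N. w n) \<le> 1" and t: "\<And>n. t n \<ge> 0"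
  shows "(\<Sum>n<N. w n * t n) powr P \<le> (\<Sum>n<N. w n * t n powr P)"
proof -
  define w' where "w' n = (if n = N then 1 - (\<Sum>n<N. w n) else w n)" for n
  define t' where "t' n = (if n = N then 0 else t n)" for n
  have "(\<Sum>n\<in>{..N}. w' n *\<^sub>R t' n) powr P \<le> (\<Sum>n\<in>{..N}. w' n * t' n powr P)"
    by (rule convex_on_sum[OF _ _ convex_on_powr_nonneg[OF assms(1)]])
       (use w t in \<open>auto simp: w'_def t'_def lessThan_Suc_atMost[symmetric]\<close>)
  then show ?thesis
    by (simp add: w'_def t'_def lessThan_Suc_atMost[symmetric])
qed

lemma lp_ball_subset_lp: "lp_ball P \<subseteq> lp P"
  by (auto simp: lp_ball_def lp_def intro!: summableI_nonneg_bounded)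

lemma lp_ball_iff:
  "y \<in> lp_ball P \<longleftrightarrow> y \<in> lp P \<and> (\<Sum>k. cmod (y k) powr P) \<le> 1"
proof
  assume y: "y \<in> lp_ball P"
  then have "y \<in> lp P" using lp_ball_subset_lp by auto
  with y show "y \<in> lp P \<and> (\<Sum>k. cmod (y k) powr P) \<le> 1"
    by (auto simp: lp_ball_def lp_def intro!: suminf_le_const)
next
  assume y: "y \<in> lp P \<and> (\<Sum>k. cmod (y k) powr P) \<le> 1"
  then have "(\<Sum>k<K. cmod (y k) powr P) \<le> 1" for K
    by (intro order.trans[OF sum_le_suminf]) (auto simp: lp_def)
  then show "y \<in> lp_ball P" by (auto simp: lp_ball_def)
qed

lemma lp_ball_cmod_le:
  assumes "P \<ge> 1" "y \<in> lp_ball P"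
  shows "cmod (y k) \<le> 1"
proof (rule ccontr)
  assume "\<not> cmod (y k) \<le> 1"
  then have "1 < cmod (y k) powr P"
    using assms(1) by (intro gr_one_powr) auto
  also have "\<dots> \<le> (\<Sum>j<Suc k. cmod (y j) powr P)"
    by (rule member_le_sum) auto
  also have "\<dots> \<le> 1" using assms(2) by (simp only: lp_ball_def mem_Collect_eq)
  finally show False by simp
qed

lemma lp_scale: "y \<in> lp P \<Longrightarrow> (\<lambda>k. c * y k) \<in> lp P"
  by (simp add: lp_def norm_mult powr_mult summable_mult)

lemma lp_add:
  assumes "P \<ge> 1" "x \<in> lp P" "y \<in> lp P"
  shows "(\<lambda>k. x k + y k) \<in> lp P"
  unfolding lp_def mem_Collect_eq
proof (rule summable_comparison_test')
  show "summable (\<lambda>k. 2 powr P * (cmod (x k) powr P + cmod (y k) powr P))"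
    using assms by (intro summable_mult summable_add) (auto simp: lp_def)
  fix k
  \<comment> \<open>Only membership in \<open>lp P\<close> is wanted, so a sum is crudely bounded by
    twice the larger term.\<close>
  have "cmod (x k + y k) powr P \<le> (2 * max (cmod (x k)) (cmod (y k))) powr P"
    using norm_triangle_ineq[of "x k" "y k"] assms(1) by (intro powr_mono2) auto
  also have "\<dots> \<le> 2 powr P * (cmod (x k) powr P + cmod (y k) powr P)"
    by (auto simp: powr_mult max_def)
  finally show "norm (cmod (x k + y k) powr P) \<le> 2 powr P * (cmod (x k) powr P + cmod (y k) powr P)"
    by simp
qed

lemma lp_finite_support: "(\<And>k. k \<ge> N \<Longrightarrow> y k = 0) \<Longrightarrow> y \<in> lp P"
  unfolding lp_def mem_Collect_eq by (rule summable_finite[of "{..<N}"]) auto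

lemma lp_ball_scale:
  assumes "P \<ge> 1" "y \<in> lp_ball P" "cmod c \<le> 1"
  shows "(\<lambda>k. c * y k) \<in> lp_ball P"
  unfolding lp_ball_def mem_Collect_eq
proof
  fix K
  have "(\<Sum>k<K. cmod (c * y k) powr P) \<le> (\<Sum>k<K. cmod (y k) powr P)"
    using assms by (intro sum_mono powr_mono2) (auto simp: norm_mult intro: mult_left_le_one_le)
  also have "\<dots> \<le> 1" using assms(2) by (auto simp: lp_ball_def)
  finally show "(\<Sum>k<K. cmod (c * y k) powr P) \<le> 1" .
qed

lemma lp_normalize:
  assumes "P \<ge> 1" "y \<in> lp P" and s: "s = (\<Sum>k. cmod (y k) powr P)" "s > 0"
  shows "(\<lambda>k. y k / of_real (s powr (1 / P))) \<in> lp_ball P"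
proof -
  have "cmod (y k / of_real (s powr (1 / P))) powr P = cmod (y k) powr P / s" for k
    using assms by (simp add: norm_divide powr_divide powr_powr)
  moreover have "(\<Sum>k. cmod (y k) powr P / s) = 1"
    using assms suminf_divide[of "\<lambda>k. cmod (y k) powr P" s] by (simp add: lp_def)
  ultimately show ?thesis
    using assms by (simp add: lp_ball_iff lp_def summable_divide)
qed

text \<open>This plays the role of completeness in the gliding hump argument. For fixed K and
  finitely many summands, Jensen and an exchange of sums give the bound 1; the number of summands
  then tends to infinity.\<close>

lemma lp_ball_sigma_convex:
  assumes P: "P \<ge> 1" and z: "\<And>n. z n \<in> lp_ball P"
    and w: "\<And>n. w n \<ge> 0" "summable w" "(\<Sum>n. w n) \<le> 1"
  shows "summable (\<lambda>n. of_real (w n) * z n k)"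
    and "(\<lambda>k. \<Sum>n. of_real (w n) * z n k) \<in> lp_ball P"
proof -
  show sm: "summable (\<lambda>n. of_real (w n) * z n k)" for k
    by (rule summable_comparison_test'[OF w(2)])
       (use w(1) lp_ball_cmod_le[OF P z] in \<open>auto simp: norm_mult intro!: mult_left_le\<close>)
  show "(\<lambda>k. \<Sum>n. of_real (w n) * z n k) \<in> lp_ball P"
    unfolding lp_ball_def mem_Collect_eq
  proof
    fix K
    have wN: "(\<Sum>n<N. w n) \<le> 1" for N
      using sum_le_suminf[OF w(2), of "{..<N}"] w by auto
    have le: "(\<Sum>k<K. cmod (\<Sum>n<N. of_real (w n) * z n k) powr P) \<le> 1" for N
    proof -
      have "(\<Sum>k<K. cmod (\<Sum>n<N. of_real (w n) * z n k) powr P)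
          \<le> (\<Sum>k<K. (\<Sum>n<N. w n * cmod (z n k)) powr P)"
        using P w(1) by (intro sum_mono powr_mono2 order.trans[OF norm_sum]) (auto simp: norm_mult)
      also have "\<dots> \<le> (\<Sum>k<K. \<Sum>n<N. w n * cmod (z n k) powr P)"
        by (intro sum_mono powr_sum_le_sum_powr P w wN) auto
      also have "\<dots> = (\<Sum>n<N. w n * (\<Sum>k<K. cmod (z n k) powr P))"
        by (subst sum.swap) (simp add: sum_distrib_left)
      also have "\<dots> \<le> (\<Sum>n<N. w n * 1)"
        using z w(1) by (intro sum_mono mult_left_mono) (auto simp: lp_ball_def)
      finally show ?thesis using wN[of N] by simp
    qed
    have "(\<lambda>N. \<Sum>k<K. cmod (\<Sum>n<N. of_real (w n) * z n k) powr P)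
        \<longlonglongrightarrow> (\<Sum>k<K. cmod (\<Sum>n. of_real (w n) * z n k) powr P)"
      using P by (intro tendsto_intros summable_LIMSEQ sm) auto
    then show "(\<Sum>k<K. cmod (\<Sum>n. of_real (w n) * z n k) powr P) \<le> 1"
      by (rule LIMSEQ_le_const2) (use le in auto)
  qed
qed

section \<open>Link between \<open>ell_norm\<close> and the spaces with a real exponent\<close>

lemma powr_inverse_le_one_iff:
  fixes s r :: real
  assumes "s \<ge> 0" "r > 0"
  shows "s powr (1 / r) \<le> 1 \<longleftrightarrow> s \<le> 1"
proof
  assume "s powr (1 / r) \<le> 1"
  then have "(s powr (1 / r)) powr r \<le> 1 powr r" using assms by (intro powr_mono2) auto
  then show "s \<le> 1" using assms by (simp add: powr_powr)
next
  assume "s \<le> 1"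
  then have "s powr (1 / r) \<le> 1 powr (1 / r)" using assms by (intro powr_mono2) auto
  then show "s powr (1 / r) \<le> 1" by simp
qed

lemma ell_eq_lp: "p \<noteq> \<infinity> \<Longrightarrow> ell p = lp (enn2real p)"
  by (auto simp: ell_def ell_norm_def lp_def)

lemma ell_norm_le_one_iff:
  assumes "1 \<le> p" "p < \<infinity>"
  shows "ell_norm p y \<le> 1 \<longleftrightarrow> y \<in> lp_ball (enn2real p)"
proof -
  have "enn2real p > 0"
    using assms by (metis enn2real_positive_iff infinity_ennreal_def less_le_trans zero_less_one)
  then show ?thesis
    using assms by (auto simp: ell_norm_def lp_ball_iff lp_def powr_inverse_le_one_iff suminf_nonneg)
qed

subsection \<open>Uniform boundedness\<close>

text \<open>Linearity is asked on \<open>lp P\<close> alone: the functionals of interest are given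
  by series, whose \<open>suminf\<close> is unspecified where they diverge.\<close>

definition lp_linear :: "real \<Rightarrow> ((nat \<Rightarrow> complex) \<Rightarrow> complex) \<Rightarrow> bool" where
  "lp_linear P T \<longleftrightarrow>
     (\<forall>x\<in>lp P. \<forall>y\<in>lp P. T (\<lambda>k. x k + y k) = T x + T y) \<and>
     (\<forall>c. \<forall>y\<in>lp P. T (\<lambda>k. c * y k) = c * T y)"

lemma lp_linear_add:
  "lp_linear P T \<Longrightarrow> x \<in> lp P \<Longrightarrow> y \<in> lp P \<Longrightarrow> T (\<lambda>k. x k + y k) = T x + T y"
  and lp_linear_scale: "lp_linear P T \<Longrightarrow> y \<in> lp P \<Longrightarrow> T (\<lambda>k. c * y k) = c * T y"
  by (auto simp: lp_linear_def)

text \<open>One of the signs 1 and -1 always works: 2b is the difference of a + b and a - b, so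
  these cannot both be shorter than b.\<close>

lemma ex_unit_norm_le_norm_add: "\<exists>s. cmod s \<le> 1 \<and> cmod b \<le> cmod (a + s * b)"
proof (cases "cmod b \<le> cmod (a + b)")
  case True
  then show ?thesis by (intro exI[of _ 1]) simp
next
  case False
  have "2 * cmod b = cmod ((a + b) - (a - b))"
    by (simp add: norm_mult[symmetric])
  also have "\<dots> \<le> cmod (a + b) + cmod (a - b)" by (rule norm_triangle_ineq4)
  finally have "cmod b \<le> cmod (a - b)" using False by linarith
  then show ?thesis by (intro exI[of _ "-1"]) simp
qed

text \<open>The weights 2/3 * (1/3)^j have sum 1, so the tail from index m on is its total weight
  3/2 * (1/3)^m times a \<sigma>-convex combination of points of the ball.\<close>

lemma lp_geometric_tail:
  assumes P: "P \<ge> 1" and z: "\<And>n. z n \<in> lp_ball P"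
  shows "\<exists>t\<in>lp_ball P. \<forall>k.
    (\<lambda>j. of_real ((1/3) ^ (m + j)) * z j k) sums (of_real (3/2 * (1/3) ^ m) * t k)"
proof -
  define w :: "nat \<Rightarrow> real" where "w j = 2/3 * (1/3) ^ j" for j
  have w: "w sums 1" "\<And>j. w j \<ge> 0"
    using sums_mult[OF geometric_sums[of "1/3::real"], of "2/3"] by (auto simp: w_def[abs_def])
  let ?t = "\<lambda>k. \<Sum>j. of_real (w j) * z j k"
  have "(\<lambda>j. of_real (w j) * z j k) sums ?t k" for k
    using lp_ball_sigma_convex(1)[OF P z] w by (intro summable_sums) (auto simp: sums_iff)
  from sums_mult[OF this, of "of_real (3/2 * (1/3) ^ m)"]
  have "(\<lambda>j. of_real ((1/3) ^ (m + j)) * z j k) sums (of_real (3/2 * (1/3) ^ m) * ?t k)" for k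
    by (simp add: w_def power_add mult_ac)
  moreover have "?t \<in> lp_ball P"
    using w by (intro lp_ball_sigma_convex(2) P z) (auto simp: sums_iff)
  ultimately show ?thesis by (intro bexI[of _ ?t]) auto
qed

text \<open>
  Sokal's elementary proof of the uniform boundedness principle: \<open>y\<close> is \<open>\<Sum>n. \<plusminus> 3\<^bsup>-n\<^esup> z n\<close>, where
  each sign is chosen so that the \<open>n\<close>-th term does not decrease \<open>\<bar>U n\<bar>\<close> below its own
  contribution.  The later terms sum to \<open>3\<^bsup>-n\<^esup> / 2\<close> times an element of the unit ball, which is too
  small to undo this.
\<close>

lemma lp_gliding_hump:
  assumes P: "P \<ge> 1" and lin: "\<And>n. lp_linear P (U n)" and z: "\<And>n. z n \<in> lp_ball P"
    and bdd: "\<And>n t. t \<in> lp_ball P \<Longrightarrow> cmod (U n t) \<le> M n"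
    and large: "\<And>n. cmod (U n (z n)) \<ge> 2/3 * M n"
  obtains y where "y \<in> lp P" "\<And>n. cmod (U n y) \<ge> (1/3) ^ n * M n / 6"
proof -
  let ?st = "\<lambda>s n x k. x k + s * of_real ((1/3) ^ n) * z n k :: complex"
  have zlp: "z n \<in> lp P" for n using z lp_ball_subset_lp by blast
  \<comment> \<open>\<open>x n\<close> is the n-th partial sum of the desired series. The sign at
    stage n depends on the sum built so far, hence the dependent choice.\<close>
  have "\<exists>x. \<forall>n. (x n \<in> lp P \<and> (n = 0 \<longrightarrow> x n = (\<lambda>_. 0))) \<and>
     (\<exists>s. cmod s \<le> 1 \<and> x (Suc n) = ?st s n (x n) \<and>
      cmod (U n (x (Suc n))) \<ge> (1/3) ^ n * cmod (U n (z n)))"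
  proof (rule dependent_nat_choice)
    show "\<exists>x. x \<in> lp P \<and> ((0::nat) = 0 \<longrightarrow> x = (\<lambda>_. 0))"
      by (auto intro: lp_finite_support)
  next
    fix x and n :: nat
    assume x: "x \<in> lp P \<and> (n = 0 \<longrightarrow> x = (\<lambda>_. 0))"
    have st: "?st s n x \<in> lp P" for s
      using x zlp P by (intro lp_add lp_scale) auto
    have U: "U n (?st s n x) = U n x + s * of_real ((1/3) ^ n) * U n (z n)" for s
      using x zlp lp_scale by (simp add: lp_linear_add[OF lin] lp_linear_scale[OF lin])
    have "(1/3) ^ n * cmod (U n (z n)) = cmod (of_real ((1/3) ^ n) * U n (z n))"
      by (simp add: norm_mult norm_power)
    then have "\<exists>s. cmod s \<le> 1 \<and> cmod (U n (?st s n x)) \<ge> (1/3) ^ n * cmod (U n (z n))"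
      unfolding U using ex_unit_norm_le_norm_add[of "of_real ((1/3) ^ n) * U n (z n)" "U n x"]
      by (simp only: mult.assoc)
    then show "\<exists>x'. (x' \<in> lp P \<and> (Suc n = 0 \<longrightarrow> x' = (\<lambda>_. 0))) \<and>
      (\<exists>s. cmod s \<le> 1 \<and> x' = ?st s n x \<and> cmod (U n x') \<ge> (1/3) ^ n * cmod (U n (z n)))"
      using st by blast
  qed
  then obtain x where x: "\<And>n. x n \<in> lp P" "x 0 = (\<lambda>_. 0)"
     "\<And>n. \<exists>s. cmod s \<le> 1 \<and> x (Suc n) = ?st s n (x n) \<and>
      cmod (U n (x (Suc n))) \<ge> (1/3) ^ n * cmod (U n (z n))"
    by blast
  then obtain s where s: "\<And>n. cmod (s n) \<le> 1" "\<And>n. x (Suc n) = ?st (s n) n (x n)"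
      "\<And>n. cmod (U n (x (Suc n))) \<ge> (1/3) ^ n * cmod (U n (z n))"
    by metis
  define z' where "z' n = (\<lambda>k. s n * z n k)" for n
  have z': "z' n \<in> lp_ball P" for n
    unfolding z'_def by (intro lp_ball_scale P z s)
  have xs: "x N k = (\<Sum>j<N. of_real ((1/3) ^ j) * z' j k)" for N k
    by (induction N) (simp_all add: x(2) s(2) z'_def mult_ac)
  obtain t0 where t0: "t0 \<in> lp_ball P"
      "\<And>k. (\<lambda>j. of_real ((1/3) ^ (0 + j)) * z' j k) sums (of_real (3/2 * (1/3) ^ 0) * t0 k)"
    using lp_geometric_tail[OF P, of z' 0, OF z'] by auto
  \<comment> \<open>3/2 is the sum of all the weights (1/3)^j, so this is the full signed
    series.\<close>
  define y where "y k = of_real (3/2) * t0 k" for k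
  have y: "(\<lambda>j. of_real ((1/3) ^ j) * z' j k) sums y k" for k
    using t0(2)[of k] by (simp add: y_def)
  have ylp: "y \<in> lp P"
    unfolding y_def using t0(1) lp_ball_subset_lp by (intro lp_scale) auto
  moreover have "cmod (U n y) \<ge> (1/3) ^ n * M n / 6" for n
  proof -
    obtain t where t: "t \<in> lp_ball P"
      "\<And>k. (\<lambda>j. of_real ((1/3) ^ (Suc n + j)) * z' (j + Suc n) k)
         sums (of_real (3/2 * (1/3) ^ Suc n) * t k)"
      using lp_geometric_tail[OF P, of "\<lambda>j. z' (j + Suc n)" "Suc n", OF z'] by auto
    have tlp: "t \<in> lp P" using t lp_ball_subset_lp by blast
    \<comment> \<open>The weight remaining after the first n + 1 terms is 3/2 * (1/3)^(n+1) = 1/2 *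
      (1/3)^n.\<close>
    have "y = (\<lambda>k. x (Suc n) k + of_real (1/2 * (1/3) ^ n) * t k)"
    proof
      fix k
      have "(\<lambda>j. of_real ((1/3) ^ (j + Suc n)) * z' (j + Suc n) k) sums (y k - x (Suc n) k)"
        using sums_split_initial_segment[OF y, of "Suc n" k] by (simp only: xs)
      moreover have "(\<lambda>j. of_real ((1/3) ^ (j + Suc n)) * z' (j + Suc n) k)
          sums (of_real (1/2 * (1/3) ^ n) * t k)"
        using t(2)[of k] by (simp add: add.commute)
      ultimately have "y k - x (Suc n) k = of_real (1/2 * (1/3) ^ n) * t k"
        by (rule sums_unique2)
      then show "y k = x (Suc n) k + of_real (1/2 * (1/3) ^ n) * t k"
        by (simp only: diff_eq_eq add.commute)
    qed
    then have "U n y = U n (x (Suc n)) + of_real (1/2 * (1/3) ^ n) * U n t"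
      by (simp only: lp_linear_add[OF lin x(1) lp_scale[OF tlp]] lp_linear_scale[OF lin tlp])
    then have "cmod (U n y) \<ge> cmod (U n (x (Suc n))) - 1/2 * (1/3) ^ n * cmod (U n t)"
      using norm_diff_ineq[of "U n (x (Suc n))" "of_real (1/2 * (1/3) ^ n) * U n t"]
      by (simp add: norm_mult norm_power norm_divide)
    moreover have "(1/3) ^ n * (2/3 * M n) \<le> (1/3) ^ n * cmod (U n (z n))"
      by (intro mult_left_mono large) simp
    moreover from this have "2/3 * ((1/3) ^ n * M n) \<le> cmod (U n (x (Suc n)))"
      using s(3)[of n] by linarith
    moreover have "1/2 * (1/3) ^ n * cmod (U n t) \<le> 1/2 * ((1/3) ^ n * M n)"
      using mult_left_mono[OF bdd[OF t(1), of n], of "(1/3) ^ n"] by simp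
    \<comment> \<open>The n-th term guarantees 2/3 and the tail removes at most 1/2, in units of
      (1/3)^n * M n; the difference is 1/6.\<close>
    ultimately show ?thesis by linarith
  qed
  ultimately show thesis using that by blast
qed

text \<open>Applied twice below: to the partial sums of a single row, then to the family of all
  rows.\<close>

theorem lp_uniform_boundedness:
  fixes T :: "'i \<Rightarrow> (nat \<Rightarrow> complex) \<Rightarrow> complex"
  assumes P: "P \<ge> 1" and lin: "\<And>i. lp_linear P (T i)"
    and bdd: "\<And>i. \<exists>C. \<forall>y\<in>lp_ball P. cmod (T i y) \<le> C"
    and pointwise: "\<And>y. y \<in> lp P \<Longrightarrow> \<exists>C. \<forall>i. cmod (T i y) \<le> C"
  shows "\<exists>C. \<forall>i. \<forall>y\<in>lp_ball P. cmod (T i y) \<le> C"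
proof (rule ccontr)
  assume unbounded: "\<not> ?thesis"
  define N where "N i = (SUP y\<in>lp_ball P. cmod (T i y))" for i
  have bdd': "bdd_above ((\<lambda>y. cmod (T i y)) ` lp_ball P)" for i
    using bdd[of i] by (auto simp: bdd_above_def)
  have N: "cmod (T i y) \<le> N i" if "y \<in> lp_ball P" for i y
    unfolding N_def by (rule cSUP_upper[OF that bdd'])
  \<comment> \<open>Norms above 4^n outweigh the factor (1/3)^n of the gliding hump: the values at y
    then grow at least like (4/3)^n / 6.\<close>
  have "\<exists>i. N i > 4 ^ n" for n :: nat
    using unbounded N by (meson less_le_trans linorder_not_le)
  then obtain I where I: "\<And>n. N (I n) > 4 ^ n" by metis
  \<comment> \<open>As \<open>N (I n)\<close> is positive, 2/3 of it lies strictly below the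
    supremum and is exceeded somewhere on the ball.\<close>
  have "\<exists>z\<in>lp_ball P. cmod (T (I n) z) > 2/3 * N (I n)" for n
  proof -
    have "0 < N (I n)" using I[of n] by (rule less_trans[rotated]) simp
    then have "2/3 * N (I n) < (SUP y\<in>lp_ball P. cmod (T (I n) y))"
      unfolding N_def[symmetric] by simp
    moreover have "lp_ball P \<noteq> {}"
      by (auto simp: lp_ball_def intro!: exI[of _ "\<lambda>_. 0"])
    ultimately show ?thesis using less_cSUP_iff[OF _ bdd'] by blast
  qed
  then obtain z where z: "\<And>n. z n \<in> lp_ball P" "\<And>n. cmod (T (I n) (z n)) > 2/3 * N (I n)"
    by metis
  obtain y where y: "y \<in> lp P" "\<And>n. cmod (T (I n) y) \<ge> (1/3) ^ n * N (I n) / 6"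
    using lp_gliding_hump[OF P, of "\<lambda>n. T (I n)" z "\<lambda>n. N (I n)"] lin N z
    by (metis less_imp_le)
  obtain C where C: "\<And>i. cmod (T i y) \<le> C" using pointwise[OF y(1)] by blast
  obtain n where n: "(4/3::real) ^ n > 6 * C" using real_arch_pow[of "4/3" "6 * C"] by auto
  have "(1/3) ^ n * 4 ^ n \<le> (1/3) ^ n * N (I n)"
    using I[of n] by (intro mult_left_mono) auto
  then have "(4/3) ^ n \<le> (1/3) ^ n * N (I n)"
    by (simp add: power_mult_distrib[symmetric])
  with n C[of "I n"] y(2)[of n] show False by simp
qed

subsection \<open>Duality\<close>

abbreviation unit_seq :: "nat \<Rightarrow> nat \<Rightarrow> complex" where
  "unit_seq k \<equiv> (\<lambda>j. if j = k then 1 else 0)"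

lemma lp_linear_finite_support:
  assumes lin: "lp_linear P T"
  shows "T (\<lambda>k. if k < K then y k else 0) = (\<Sum>k<K. y k * T (unit_seq k))"
proof (induction K)
  case 0
  have "T (\<lambda>k. 0 * 0) = 0 * T (\<lambda>_. 0)"
    by (rule lp_linear_scale[OF lin]) (rule lp_finite_support, simp)
  then show ?case by simp
next
  case (Suc K)
  have e: "unit_seq K \<in> lp P" by (rule lp_finite_support[of "Suc K"]) auto
  have t: "(\<lambda>k. if k < K then y k else 0) \<in> lp P" by (rule lp_finite_support[of K]) auto
  have "(\<lambda>k. if k < Suc K then y k else 0)
      = (\<lambda>k. (if k < K then y k else 0) + y K * unit_seq K k)"
    by (auto simp: fun_eq_iff less_Suc_eq)
  then have "T (\<lambda>k. if k < Suc K then y k else 0)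
      = T (\<lambda>k. if k < K then y k else 0) + y K * T (unit_seq K)"
    by (simp only: lp_linear_add[OF lin t lp_scale[OF e]] lp_linear_scale[OF lin e])
  with Suc show ?case by simp
qed

lemma lp_linear_bound:
  assumes P: "P \<ge> 1" and lin: "lp_linear P T"
    and bdd: "\<And>y. y \<in> lp_ball P \<Longrightarrow> cmod (T y) \<le> C" and y: "y \<in> lp P"
  shows "cmod (T y) \<le> C * (\<Sum>k. cmod (y k) powr P) powr (1 / P)"
proof -
  let ?s = "\<Sum>k. cmod (y k) powr P"
  have sm: "summable (\<lambda>k. cmod (y k) powr P)" using y by (simp add: lp_def)
  have "?s \<ge> 0" by (intro suminf_nonneg sm) auto
  then consider "?s = 0" | "?s > 0" by linarith
  then show ?thesis
  proof cases
    case 1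
    \<comment> \<open>The zero sequence is viewed as a truncation at 0, for which
      \<open>lp_linear_finite_support\<close> yields an empty sum.\<close>
    then have "y = (\<lambda>k. if k < 0 then y k else 0)"
      using suminf_eq_zero_iff[OF sm] P by (auto simp: fun_eq_iff)
    then have "T y = 0" using lp_linear_finite_support[OF lin, of 0 y] by simp
    then show ?thesis using 1 by simp
  next
    case 2
    let ?r = "?s powr (1 / P)"
    have r: "?r > 0" using 2 by simp
    have n: "(\<lambda>k. y k / of_real ?r) \<in> lp_ball P"
      by (rule lp_normalize[OF P y refl 2])
    have "T y = T (\<lambda>k. of_real ?r * (y k / of_real ?r))" using r by simp
    also have "\<dots> = of_real ?r * T (\<lambda>k. y k / of_real ?r)"
      by (rule lp_linear_scale[OF lin]) (use n lp_ball_subset_lp in blast)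
    finally have "cmod (T y) = ?r * cmod (T (\<lambda>k. y k / of_real ?r))"
      by (simp add: norm_mult)
    then show ?thesis using bdd[OF n] r by (simp add: mult.commute)
  qed
qed

text \<open>Subtracting the value at the K-th truncation leaves T at a tail of y. The norms of the
  tails tend to 0, and boundedness of T carries this over to its values.\<close>

lemma lp_linear_sums:
  assumes P: "P \<ge> 1" and lin: "lp_linear P T"
    and bdd: "\<And>y. y \<in> lp_ball P \<Longrightarrow> cmod (T y) \<le> C" and y: "y \<in> lp P"
  shows "(\<lambda>k. y k * T (unit_seq k)) sums T y"
proof -
  have sm: "summable (\<lambda>k. cmod (y k) powr P)" using y by (simp add: lp_def)
  have tail_summable: "summable (\<lambda>k. cmod (y (k + K)) powr P)" for K
    by (rule summable_ignore_initial_segment[OF sm])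
  define tail where "tail K k = (if k < K then 0 else y k)" for K k
  have tail_sums: "(\<lambda>k. cmod (tail K k) powr P) sums (\<Sum>k. cmod (y (k + K)) powr P)" for K
  proof -
    have "(\<lambda>k. cmod (tail K (k + K)) powr P) sums (\<Sum>k. cmod (y (k + K)) powr P)"
      using tail_summable[of K] by (simp add: tail_def summable_sums)
    then show ?thesis
      by (subst (asm) sums_iff_shift) (simp add: tail_def)
  qed
  then have tail: "tail K \<in> lp P" for K by (auto simp: lp_def sums_iff)
  have split: "(\<Sum>k<K. y k * T (unit_seq k)) = T y - T (tail K)" for K
  proof -
    have "(\<lambda>k. if k < K then y k else 0) \<in> lp P" by (rule lp_finite_support[of K]) auto
    moreover have "y = (\<lambda>k. (if k < K then y k else 0) + tail K k)"
      by (auto simp: tail_def)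
    ultimately have "T y = T (\<lambda>k. if k < K then y k else 0) + T (tail K)"
      using lp_linear_add[OF lin _ tail[of K]] by metis
    then show ?thesis by (simp add: lp_linear_finite_support[OF lin])
  qed
  \<comment> \<open>The limiting base is 0; passing to the limit in the power there rests on 1 / P >
    0 and on nonnegative tail sums.\<close>
  have "(\<lambda>K. C * (\<Sum>k. cmod (y (k + K)) powr P) powr (1 / P)) \<longlonglongrightarrow> C * 0 powr (1 / P)"
    using P sm
    by (intro tendsto_intros suminf_exist_split2 disjI2 conjI always_eventually allI suminf_nonneg)
       (auto simp: tail_summable)
  then have "(\<lambda>K. C * (\<Sum>k. cmod (y (k + K)) powr P) powr (1 / P)) \<longlonglongrightarrow> 0" by simp
  then have "(\<lambda>K. T (tail K)) \<longlonglongrightarrow> 0"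
  proof (rule Lim_null_comparison[rotated], intro always_eventually allI)
    fix K
    show "cmod (T (tail K)) \<le> C * (\<Sum>k. cmod (y (k + K)) powr P) powr (1 / P)"
      using lp_linear_bound[OF P lin bdd tail[of K]] sums_unique[OF tail_sums[of K]] by simp
  qed
  from tendsto_diff[OF tendsto_const[of "T y"] this] show ?thesis
    by (simp add: sums_def split)
qed

text \<open>After c is normalised, Young's inequality applies termwise and the two sums contribute
  at most 1 / P + 1 / Q = 1.\<close>

lemma lp_hoelder:
  assumes PQ: "P > 1" "Q > 1" "1 / P + 1 / Q = 1" and y: "y \<in> lp_ball P" and c: "c \<in> lp Q"
  shows "(\<Sum>k<K. cmod (y k) * cmod (c k)) \<le> (\<Sum>k. cmod (c k) powr Q) powr (1 / Q)"
proof -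
  let ?s = "\<Sum>k. cmod (c k) powr Q"
  have sm: "summable (\<lambda>k. cmod (c k) powr Q)" using c by (simp add: lp_def)
  have "?s \<ge> 0" by (intro suminf_nonneg sm) auto
  then consider "?s = 0" | "?s > 0" by linarith
  then show ?thesis
  proof cases
    case 1
    then show ?thesis using suminf_eq_zero_iff[OF sm] PQ by simp
  next
    case 2
    let ?r = "?s powr (1 / Q)"
    have r: "?r > 0" using 2 by simp
    have n: "(\<lambda>k. c k / of_real ?r) \<in> lp_ball Q"
      using PQ by (intro lp_normalize[OF _ c refl 2]) auto
    have "(\<Sum>k<K. cmod (y k) * cmod (c k / of_real ?r))
        \<le> (\<Sum>k<K. cmod (y k) powr P / P + cmod (c k / of_real ?r) powr Q / Q)"
      by (intro sum_mono Youngs_inequality PQ) auto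
    also have "\<dots> = (\<Sum>k<K. cmod (y k) powr P) / P + (\<Sum>k<K. cmod (c k / of_real ?r) powr Q) / Q"
      by (simp add: sum.distrib sum_divide_distrib)
    also have "\<dots> \<le> 1 / P + 1 / Q"
      using y n PQ by (intro add_mono divide_right_mono) (auto simp: lp_ball_def)
    finally have "(\<Sum>k<K. cmod (y k) * cmod (c k) / ?r) \<le> 1"
      using PQ r by (simp add: norm_divide)
    then show ?thesis using r by (simp add: sum_divide_distrib[symmetric] divide_le_eq_1)
  qed
qed

text \<open>Tests \<open>T\<close> on the extremal sequence of Hoelder's inequality, truncated at \<open>K\<close>.\<close>

lemma lp_dual_extremal:
  assumes PQ: "P > 1" "Q > 1" "1 / P + 1 / Q = 1" and lin: "lp_linear P T"
    and bdd: "\<And>y. y \<in> lp_ball P \<Longrightarrow> cmod (T y) \<le> C"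
  shows "(\<Sum>k<K. cmod (T (unit_seq k)) powr Q) \<le> C powr Q"
proof -
  let ?c = "\<lambda>k. T (unit_seq k)"
  define s where "s = (\<Sum>k<K. cmod (?c k) powr Q)"
  \<comment> \<open>The factor \<open>cnj (sgn _)\<close> makes each product with the coefficient
    nonnegative. The exponent Q - 1 satisfies (Q - 1) * P = Q, so both that product and the P-th
    power of the modulus equal the Q-th power of the coefficient's modulus.\<close>
  define z where "z k = cnj (sgn (?c k)) * of_real (cmod (?c k) powr (Q - 1))" for k
  define y where "y k = (if k < K then z k else 0)" for k
  have PQ': "(Q - 1) * P = Q" using PQ by (simp add: field_simps)
  have y: "y \<in> lp P" by (rule lp_finite_support[of K]) (auto simp: y_def)
  have zc: "z k * ?c k = of_real (cmod (?c k) powr Q)" for k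
  proof (cases "?c k = 0")
    case False
    have "cnj (sgn (?c k)) * ?c k = of_real (cmod (?c k))"
      using complex_norm_square[of "?c k"] False
      by (simp add: sgn_eq power2_eq_square mult.commute divide_eq_eq)
    then have "z k * ?c k = of_real (cmod (?c k) * cmod (?c k) powr (Q - 1))"
      by (simp add: z_def mult.assoc mult.left_commute[of _ "of_real _"] mult.commute)
    also have "cmod (?c k) * cmod (?c k) powr (Q - 1) = cmod (?c k) powr Q"
      using False powr_add[of "cmod (?c k)" 1 "Q - 1"] by simp
    finally show ?thesis .
  qed (use PQ in \<open>simp add: z_def\<close>)
  have zP: "cmod (z k) powr P = cmod (?c k) powr Q" for k
    using PQ by (simp add: z_def norm_mult norm_sgn powr_mult powr_powr PQ')
  have "T y = (\<Sum>k<K. z k * ?c k)"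
    unfolding y_def by (rule lp_linear_finite_support[OF lin])
  then have "T y = of_real s" by (simp add: zc s_def)
  moreover have "s \<ge> 0" unfolding s_def by (intro sum_nonneg) auto
  moreover have "(\<Sum>k. cmod (y k) powr P) = s"
    by (subst suminf_finite[of "{..<K}"]) (auto simp: y_def s_def zP)
  ultimately have le: "s \<le> C * s powr (1 / P)"
    using lp_linear_bound[OF _ lin bdd y] PQ by simp
  show ?thesis
  proof (cases "s = 0")
    case False
    with \<open>s \<ge> 0\<close> have s: "s > 0" by simp
    \<comment> \<open>Cancelling s powr (1 / P) in the bound for s leaves s powr (1 / Q) \<le>
      C.\<close>
    have "s powr (1 / P) * s powr (1 / Q) = s"
      using s PQ by (simp add: powr_add[symmetric])
    then have "s powr (1 / P) * s powr (1 / Q) \<le> s powr (1 / P) * C"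
      using le by (simp add: mult.commute)
    then have "s powr (1 / Q) \<le> C" using s by simp
    then have "(s powr (1 / Q)) powr Q \<le> C powr Q" using PQ by (intro powr_mono2) auto
    then show ?thesis using s PQ by (simp add: powr_powr s_def)
  qed (simp add: s_def)
qed

text \<open>Moves the relation from \<open>ennreal\<close>, where 1 / \<infinity> = 0, to real
  exponents, so that the analysis for p > 1 is free of infinite values.\<close>

lemma conjugate_exponent_cases:
  fixes p q :: ennreal
  assumes "1 \<le> p" "p < \<infinity>" "1 / p + 1 / q = 1"
  obtains "p = 1" "q = \<infinity>"
    | "enn2real p > 1" "enn2real q > 1" "1 / enn2real p + 1 / enn2real q = 1" "q \<noteq> \<infinity>"
proof -
  obtain P where P: "p = ennreal P" "P \<ge> 1"
    using assms by (cases p) auto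
  show thesis
  proof (cases "p = 1")
    case True
    then have "1 + 1 / q = 1 + 0" using assms(3) by simp
    then have "q = \<infinity>" unfolding ennreal_add_left_cancel by simp
    with True show thesis using that by blast
  next
    case False
    then have "P > 1" using P by (metis ennreal_1 less_eq_real_def)
    have "q \<noteq> \<infinity>"
    proof
      assume "q = \<infinity>"
      then have "1 / p = 1" using assms(3) by simp
      from arg_cong[OF this, of "\<lambda>t. 1 / t"] show False using False by simp
    qed
    then obtain Q where Q: "q = ennreal Q" "Q \<ge> 0" by (cases q) auto
    \<comment> \<open>In \<open>ennreal\<close> the quotient 1 / 0 is infinite, which the equation
      excludes.\<close>
    have "q \<noteq> 0" using assms(3) by auto
    then have "Q > 0" using Q by (cases "Q = 0") auto
    then have "1 / p = ennreal (1 / P)" "1 / q = ennreal (1 / Q)"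
      using divide_ennreal[of 1 P] divide_ennreal[of 1 Q] P Q by simp_all
    then have "ennreal (1 / P + 1 / Q) = 1"
      using assms(3) P Q by (simp add: ennreal_plus[symmetric] del: ennreal_plus)
    then have e: "1 / P + 1 / Q = 1"
      by simp
    have "1 / P > 0" using \<open>P > 1\<close> by simp
    then have "1 / Q < 1" using e by linarith
    then have "Q > 1" using \<open>Q > 0\<close> by simp
    with that \<open>P > 1\<close> e P Q \<open>q \<noteq> \<infinity>\<close> show thesis by simp
  qed
qed

text \<open>The supremum dominates the norm by testing on unit sequences (p = 1) or truncated
  extremal sequences (p > 1). Conversely, T is the limit of its finite sums, which the sup bound or
  Hoelder's inequality controls.\<close>

theorem lp_dual_norm:
  assumes pq: "1 \<le> p" "p < \<infinity>" "1 / p + 1 / q = 1" and lin: "lp_linear (enn2real p) T"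
    and bdd: "\<And>y. y \<in> lp_ball (enn2real p) \<Longrightarrow> cmod (T y) \<le> C"
  shows "(SUP y\<in>lp_ball (enn2real p). ennreal (cmod (T y))) = ell_norm q (\<lambda>k. T (unit_seq k))"
    (is "?S = ell_norm q ?c")
proof (rule antisym)
  have "enn2real p \<ge> 1"
    using pq by (auto elim: conjugate_exponent_cases)
  have "?S \<le> ennreal C" using bdd by (intro SUP_least ennreal_leI) auto
  \<comment> \<open>C is an arbitrary bound; D is the optimal one, and testing against it gives the
    sharp estimate.\<close>
  then obtain D where D: "?S = ennreal D" "D \<ge> 0"
    by (cases ?S) (auto simp: top_unique)
  have bddD: "cmod (T y) \<le> D" if "y \<in> lp_ball (enn2real p)" for y
  proof -
    have "ennreal (cmod (T y)) \<le> ennreal D"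
      unfolding D(1)[symmetric] by (rule SUP_upper[OF that])
    then show ?thesis using D(2) by simp
  qed
  show ge: "ell_norm q ?c \<le> ?S"
    using pq
  proof (cases rule: conjugate_exponent_cases)
    case 1
    have "unit_seq k \<in> lp_ball 1" for k
    proof -
      have "(\<Sum>j<K. cmod (unit_seq k j)) \<le> 1" for K
        by (simp add: if_distrib cong: if_cong)
      then show ?thesis by (simp add: lp_ball_def)
    qed
    then show ?thesis
      unfolding D using 1 bddD by (auto simp: ell_norm_def intro!: SUP_least ennreal_leI)
  next
    case 2
    note ex = lp_dual_extremal[OF 2(1-3) lin bddD]
    have sm: "summable (\<lambda>k. cmod (?c k) powr enn2real q)"
      by (rule summableI_nonneg_bounded[OF _ ex]) auto
    have "(\<Sum>k. cmod (?c k) powr enn2real q) powr (1 / enn2real q)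
        \<le> (D powr enn2real q) powr (1 / enn2real q)"
      using 2 by (intro powr_mono2 suminf_le_const[OF sm ex] suminf_nonneg sm) auto
    also have "\<dots> = D" using D(2) 2 by (simp add: powr_powr)
    finally show ?thesis
      unfolding D using 2 sm by (simp add: ell_norm_def ennreal_leI)
  qed
  have fin: "ell_norm q ?c < \<infinity>" using ge D by (simp add: le_less_trans)
  show "?S \<le> ell_norm q ?c"
  proof (rule SUP_least)
    fix y assume y: "y \<in> lp_ball (enn2real p)"
    have lim: "(\<lambda>K. cmod (\<Sum>k<K. y k * ?c k)) \<longlonglongrightarrow> cmod (T y)"
      using lp_linear_sums[OF \<open>enn2real p \<ge> 1\<close> lin bdd] y lp_ball_subset_lp
      by (intro tendsto_norm) (auto simp: sums_def)
    obtain E where E: "ell_norm q ?c = ennreal E" "E \<ge> 0"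
      using fin by (cases "ell_norm q ?c") auto
    have "cmod (\<Sum>k<K. y k * ?c k) \<le> E" for K
      using pq
    proof (cases rule: conjugate_exponent_cases)
      case 1
      have c: "cmod (?c k) \<le> E" for k
      proof -
        have "ennreal (cmod (?c k)) \<le> ennreal E"
          unfolding E(1)[symmetric] using 1 by (auto simp: ell_norm_def intro: SUP_upper)
        then show ?thesis using E(2) by simp
      qed
      have "cmod (\<Sum>k<K. y k * ?c k) \<le> (\<Sum>k<K. cmod (y k) * E)"
        by (rule order.trans[OF norm_sum]) (auto simp: norm_mult intro!: sum_mono mult_left_mono c)
      also have "\<dots> = (\<Sum>k<K. cmod (y k)) * E" by (simp add: sum_distrib_right)
      also have "\<dots> \<le> 1 * E"
        using y 1 E(2) by (intro mult_right_mono) (auto simp: lp_ball_def)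
      finally show ?thesis by simp
    next
      case 2
      have c: "?c \<in> lp (enn2real q)"
        using fin 2 by (auto simp: lp_def ell_norm_def split: if_splits)
      have "cmod (\<Sum>k<K. y k * ?c k) \<le> (\<Sum>k<K. cmod (y k) * cmod (?c k))"
        by (rule order.trans[OF norm_sum]) (simp add: norm_mult)
      also have "\<dots> \<le> (\<Sum>k. cmod (?c k) powr enn2real q) powr (1 / enn2real q)"
        by (rule lp_hoelder[OF 2(1-3) y c])
      also have "\<dots> = E"
        using E 2 c by (simp add: lp_def ell_norm_def)
      finally show ?thesis .
    qed
    then have "cmod (T y) \<le> E" by (intro LIMSEQ_le_const2[OF lim]) auto
    then show "ennreal (cmod (T y)) \<le> ell_norm q ?c" unfolding E by (rule ennreal_leI)
  qed
qed

subsection \<open>Matrix maps on \<open>\<ell>\<^sub>p(\<Delta>\<^sup>\<alpha>)\<close>\<close>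

text \<open>As a product of formal power series, the convolution can be inverted by associativity in
  the ring.\<close>

lemma frac_diff_fps:
  "Abs_fps (frac_diff \<alpha> x) = Abs_fps (\<lambda>i. of_real (frac_coeff \<alpha> i)) * Abs_fps x"
  by (simp add: fps_eq_iff fps_mult_nth frac_diff_def atLeast0AtMost)

text \<open>The two coefficient series multiply to 1. Using this for both \<alpha> and -\<alpha>
  gives a two-sided inverse.\<close>

lemma frac_diff_inverse:
  assumes "\<alpha> \<notin> \<int>"
  shows "frac_diff (- \<alpha>) (frac_diff \<alpha> x) = x"
proof -
  have "Abs_fps (\<lambda>i. of_real (frac_coeff (- \<alpha>) i)) * Abs_fps (\<lambda>i. of_real (frac_coeff \<alpha> i))
      = (1 :: complex fps)"
    using frac_coeff_convolution[of "- \<alpha>"] assms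
    by (simp add: fps_eq_iff fps_mult_nth atLeast0AtMost flip: of_real_mult of_real_sum)
  then have "Abs_fps (frac_diff (- \<alpha>) (frac_diff \<alpha> x)) = Abs_fps x"
    by (simp add: frac_diff_fps mult.assoc[symmetric])
  then show ?thesis by (metis fps_nth_Abs_fps ext)
qed

lemma frac_diff_add: "frac_diff \<alpha> (\<lambda>k. x k + y k) = (\<lambda>k. frac_diff \<alpha> x k + frac_diff \<alpha> y k)"
  by (simp add: frac_diff_def fun_eq_iff algebra_simps sum.distrib)

lemma frac_diff_scale: "frac_diff \<alpha> (\<lambda>k. c * y k) = (\<lambda>k. c * frac_diff \<alpha> y k)"
  by (simp add: frac_diff_def fun_eq_iff sum_distrib_left algebra_simps)

lemma frac_diff_unit_seq:
  "frac_diff \<alpha> (unit_seq k) j = (if j < k then 0 else of_real (frac_coeff \<alpha> (j - k)))"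
proof (cases "j < k")
  case True
  then show ?thesis by (auto simp: frac_diff_def intro!: sum.neutral)
next
  case False
  then have "frac_diff \<alpha> (unit_seq k) j
      = (\<Sum>i\<le>j. if i = j - k then of_real (frac_coeff \<alpha> i) else 0)"
    unfolding frac_diff_def by (intro sum.cong) auto
  with False show ?thesis by simp
qed

text \<open>The bound depends on k, which suffices for estimating finite sections of a row.\<close>

lemma cmod_frac_diff_le:
  assumes "\<And>k. cmod (y k) \<le> 1"
  shows "cmod (frac_diff \<alpha> y k) \<le> (\<Sum>i\<le>k. \<bar>frac_coeff \<alpha> i\<bar>)"
  unfolding frac_diff_def
  by (rule order.trans[OF norm_sum]) (auto simp: norm_mult assms intro!: sum_mono mult_left_le)

lemma mat_class_mono: "Y \<subseteq> Z \<Longrightarrow> mat_class X Y \<subseteq> mat_class X Z"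
  by (auto simp: mat_class_def)

lemma convergent_seqs_subset_ell_infinity: "convergent_seqs \<subseteq> ell \<infinity>"
proof
  fix x assume "x \<in> convergent_seqs"
  then have "Bseq x" by (simp add: convergent_seqs_def convergent_imp_Bseq)
  then obtain K where "\<And>k. cmod (x k) \<le> K" by (auto simp: Bseq_def)
  then have "ell_norm \<infinity> x \<le> ennreal K"
    by (auto simp: ell_norm_def intro!: SUP_least ennreal_leI)
  then show "x \<in> ell \<infinity>" by (simp add: ell_def le_less_trans)
qed

lemma null_seqs_subset_convergent_seqs: "null_seqs \<subseteq> convergent_seqs"
  by (auto simp: null_seqs_def convergent_seqs_def convergent_def)

section \<open>Rows of a fixed matrix as functionals on \<open>lp P\<close>\<close>

context
  fixes \<alpha> :: real and p :: ennreal and A :: "nat \<Rightarrow> nat \<Rightarrow> complex"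
  assumes \<alpha>: "\<alpha> \<notin> \<int>" and p: "1 \<le> p" "p < \<infinity>"
    and A: "A \<in> mat_class (ell_frac \<alpha> p) (ell \<infinity>)"
begin

abbreviation (input) P where "P \<equiv> enn2real p"

lemma P: "P \<ge> 1"
  using p by (cases p) auto

lemma frac_diff_neg_mem: "y \<in> lp P \<Longrightarrow> frac_diff (- \<alpha>) y \<in> ell_frac \<alpha> p"
  using p frac_diff_inverse[of "- \<alpha>" y] \<alpha> by (simp add: ell_frac_def ell_eq_lp)

lemma summable_row: "y \<in> lp P \<Longrightarrow> summable (\<lambda>j. A n j * frac_diff (- \<alpha>) y j)"
  using A frac_diff_neg_mem by (auto simp: mat_class_def)

lemma lp_linear_row: "lp_linear P (\<lambda>y. mat_apply A (frac_diff (- \<alpha>) y) n)"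
  by (auto simp: lp_linear_def mat_apply_def frac_diff_add frac_diff_scale distrib_left
      mult.left_commute suminf_add[symmetric] suminf_mult summable_row)

lemma row_bounded: "\<exists>C. \<forall>y\<in>lp_ball P. cmod (mat_apply A (frac_diff (- \<alpha>) y) n) \<le> C"
proof -
  define S where "S m y = (\<Sum>j<m. A n j * frac_diff (- \<alpha>) y j)" for m y
  have lim: "(\<lambda>m. S m y) \<longlonglongrightarrow> mat_apply A (frac_diff (- \<alpha>) y) n" if "y \<in> lp P" for y
    unfolding S_def mat_apply_def by (rule summable_LIMSEQ[OF summable_row[OF that]])
  \<comment> \<open>Each finite section is bounded on the ball because the coordinates there are at
    most 1 in modulus; convergence of the row series supplies the pointwise bound over m.\<close>
  have "\<exists>C. \<forall>m. \<forall>y\<in>lp_ball P. cmod (S m y) \<le> C"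
  proof (rule lp_uniform_boundedness[OF P])
    show "lp_linear P (S m)" for m
      by (simp add: S_def lp_linear_def frac_diff_add frac_diff_scale distrib_left sum.distrib
          mult.left_commute sum_distrib_left)
    show "\<exists>C. \<forall>y\<in>lp_ball P. cmod (S m y) \<le> C" for m
    proof (intro exI ballI)
      fix y assume "y \<in> lp_ball P"
      then show "cmod (S m y) \<le> (\<Sum>j<m. cmod (A n j) * (\<Sum>i\<le>j. \<bar>frac_coeff (- \<alpha>) i\<bar>))"
        unfolding S_def using lp_ball_cmod_le[OF P]
        by (intro order.trans[OF norm_sum] sum_mono)
           (auto simp: norm_mult intro!: mult_left_mono cmod_frac_diff_le)
    qed
    show "\<exists>C. \<forall>m. cmod (S m y) \<le> C" if "y \<in> lp P" for y
      using convergentI[OF lim[OF that], THEN convergent_imp_Bseq] by (auto simp: Bseq_def)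
  qed
  then obtain C where C: "\<And>m y. y \<in> lp_ball P \<Longrightarrow> cmod (S m y) \<le> C" by blast
  have "cmod (mat_apply A (frac_diff (- \<alpha>) y) n) \<le> C" if "y \<in> lp_ball P" for y
    using lim[THEN tendsto_norm, of y] lp_ball_subset_lp that C
    by (intro LIMSEQ_le_const2[where a = C and X = "\<lambda>m. cmod (S m y)"]) auto
  then show ?thesis by blast
qed

text \<open>Here the pointwise bound over n is boundedness of the image sequence; the result yields
  finiteness of \<open>mat_norm\<close>.\<close>

lemma rows_uniformly_bounded:
  "\<exists>C. \<forall>n. \<forall>y\<in>lp_ball P. cmod (mat_apply A (frac_diff (- \<alpha>) y) n) \<le> C"
proof (rule lp_uniform_boundedness[OF P lp_linear_row row_bounded])
  fix y assume "y \<in> lp P"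
  then have fin: "ell_norm \<infinity> (mat_apply A (frac_diff (- \<alpha>) y)) < \<infinity>"
    using A frac_diff_neg_mem by (auto simp: mat_class_def ell_def)
  then obtain D where D: "ell_norm \<infinity> (mat_apply A (frac_diff (- \<alpha>) y)) = ennreal D" "D \<ge> 0"
    by (cases "ell_norm \<infinity> (mat_apply A (frac_diff (- \<alpha>) y))") auto
  have "ennreal (cmod (mat_apply A (frac_diff (- \<alpha>) y) n)) \<le> ennreal D" for n
    unfolding D(1)[symmetric] by (auto simp: ell_norm_def intro: SUP_upper)
  then show "\<exists>C. \<forall>n. cmod (mat_apply A (frac_diff (- \<alpha>) y) n) \<le> C"
    using D(2) by auto
qed

lemma row_unit_seq: "mat_apply A (frac_diff (- \<alpha>) (unit_seq k)) n = hat_mat \<alpha> A n k"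
proof -
  let ?f = "\<lambda>j. A n j * frac_diff (- \<alpha>) (unit_seq k) j"
  have "(\<lambda>i. ?f (i + k)) sums hat_mat \<alpha> A n k"
    using summable_sums[OF summable_hat_mat[OF \<alpha> A, of n k]]
    by (simp add: hat_mat_def frac_diff_unit_seq mult.commute add.commute)
  \<comment> \<open>The terms with index below k vanish, so undoing the shift by k leaves the sum
    unchanged.\<close>
  then have "?f sums hat_mat \<alpha> A n k"
    by (subst (asm) sums_iff_shift) (simp add: frac_diff_unit_seq)
  then show ?thesis by (simp add: mat_apply_def sums_iff)
qed

lemma frac_unit_ball: "{x \<in> ell_frac \<alpha> p. ell_frac_norm \<alpha> p x \<le> 1} = frac_diff (- \<alpha>) ` lp_ball P"
proof (intro equalityI subsetI)
  fix x assume "x \<in> {x \<in> ell_frac \<alpha> p. ell_frac_norm \<alpha> p x \<le> 1}"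
  then have "frac_diff \<alpha> x \<in> lp_ball P"
    using p by (simp add: ell_frac_norm_def ell_norm_le_one_iff)
  then show "x \<in> frac_diff (- \<alpha>) ` lp_ball P"
    by (metis frac_diff_inverse[OF \<alpha>] imageI)
next
  fix x assume "x \<in> frac_diff (- \<alpha>) ` lp_ball P"
  then obtain y where y: "y \<in> lp_ball P" "x = frac_diff (- \<alpha>) y" by blast
  then show "x \<in> {x \<in> ell_frac \<alpha> p. ell_frac_norm \<alpha> p x \<le> 1}"
    using frac_diff_neg_mem lp_ball_subset_lp frac_diff_inverse[of "- \<alpha>" y] \<alpha> p
    by (auto simp: ell_frac_norm_def ell_norm_le_one_iff)
qed

lemma row_norm:
  assumes "1 / p + 1 / q = 1"
  shows "(SUP y\<in>lp_ball P. ennreal (cmod (mat_apply A (frac_diff (- \<alpha>) y) n)))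
    = ell_norm q (hat_mat \<alpha> A n)"
  using lp_dual_norm[OF p assms lp_linear_row[of n]] row_bounded[of n]
  unfolding row_unit_seq by auto

text \<open>The operator norm is a double supremum over y and n. Exchanging the two makes the inner
  supremum the norm of a single row.\<close>

lemma op_norm_mat_apply:
  assumes "1 / p + 1 / q = 1"
  shows "op_norm (ell_frac \<alpha> p) (ell_frac_norm \<alpha> p) (ell_norm \<infinity>) (mat_apply A) = mat_norm \<alpha> q A"
proof -
  have "op_norm (ell_frac \<alpha> p) (ell_frac_norm \<alpha> p) (ell_norm \<infinity>) (mat_apply A)
      = (SUP y\<in>lp_ball P. SUP n. ennreal (cmod (mat_apply A (frac_diff (- \<alpha>) y) n)))"
    by (simp add: op_norm_def frac_unit_ball image_image ell_norm_def)
  also have "\<dots> = (SUP n. SUP y\<in>lp_ball P. ennreal (cmod (mat_apply A (frac_diff (- \<alpha>) y) n)))"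
    by (rule SUP_commute)
  finally show ?thesis by (simp add: row_norm[OF assms] mat_norm_def)
qed

lemma mat_norm_finite:
  assumes "1 / p + 1 / q = 1"
  shows "mat_norm \<alpha> q A < \<infinity>"
proof -
  obtain C where C: "\<And>n y. y \<in> lp_ball P \<Longrightarrow> cmod (mat_apply A (frac_diff (- \<alpha>) y) n) \<le> C"
    using rows_uniformly_bounded by blast
  have "mat_norm \<alpha> q A \<le> ennreal C"
    unfolding mat_norm_def row_norm[OF assms, symmetric]
    by (intro SUP_least ennreal_leI C)
  then show ?thesis by (simp add: le_less_trans)
qed

end

theorem theorem2p9:
  fixes \<alpha> :: real and p q :: ennreal and A :: "nat \<Rightarrow> nat \<Rightarrow> complex"
  assumes "\<alpha> \<notin> \<int>"
    and "1 \<le> p" and "p < \<infinity>"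
    and "1 / p + 1 / q = 1"
    and "A \<in> mat_class (ell_frac \<alpha> p) null_seqs \<or>
         A \<in> mat_class (ell_frac \<alpha> p) convergent_seqs \<or>
         A \<in> mat_class (ell_frac \<alpha> p) (ell \<infinity>)"
  shows "op_norm (ell_frac \<alpha> p) (ell_frac_norm \<alpha> p) (ell_norm \<infinity>) (mat_apply A) = mat_norm \<alpha> q A
    \<and> mat_norm \<alpha> q A < \<infinity>"
proof -
  \<comment> \<open>All three targets lie in \<open>ell \<infinity>\<close> and carry the same sup
    norm, so this one case covers the others.\<close>
  have "A \<in> mat_class (ell_frac \<alpha> p) (ell \<infinity>)"
    using assms(5) mat_class_mono[OF convergent_seqs_subset_ell_infinity]
      mat_class_mono[OF null_seqs_subset_convergent_seqs] by blast
  then show ?thesis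
    using op_norm_mat_apply mat_norm_finite assms by blast
qed

end
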